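(* Let $\alpha_1,\dots,\alpha_N>0$, let $A$ be the $N\times N$ matrix with $A_{j,k}=2\alpha_{k+1}/\alpha_k$ if $k=j-1$ and $A_{j,k}=0$ otherwise, and let $J=\mathrm{diag}(1,2,\dots,N)$. Consider the differential operators, acting from the right on $M_N(\mathbb{C})$-valued functions, $$\mathcal{D}=\partial_x+A,\qquad \mathcal{D}^\dagger=-\partial_x-A+2x,\qquad D=-\tfrac12\partial_x^2+\partial_x(xI-A)+J .$$ Then the identity operator together with $\mathcal{D},\mathcal{D}^\dagger,D$ generate a four dimensional Lie algebra $\mathfrak{h}$, the harmonic oscillator algebra.
   Context: Differential operators act from the right: $F\cdot\sum_j\partial_x^jF_j(x)=\sum_jF^{(j)}(x)F_j(x)$; products are defined by $F\cdot(\mathcal{D}_1\mathcal{D}_2)=(F\cdot\mathcal{D}_1)\cdot\mathcal{D}_2$, and the Lie bracket is the commutator. The harmonic oscillator algebra is the complex four dimensional Lie algebra with basis $\mathcal{J}^+,\mathcal{J}^-,\mathcal{J}^3,\mathcal{E}$ and brackets $[\mathcal{J}^3,\mathcal{J}^{\pm}]=\pm\mathcal{J}^{\pm}$, $[\mathcal{J}^+,\mathcal{J}^-]=-\mathcal{E}$, with $\mathcal{E}$ central. *)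

theory Defs
  imports "HOL-Analysis.Analysis"
begin

section \<open>Smooth matrix-valued functions on the real line\<close>

abbreviation vderiv :: "(real \<Rightarrow> 'a::real_normed_vector) \<Rightarrow> real \<Rightarrow> 'a" where
  "vderiv F \<equiv> (\<lambda>x. vector_derivative F (at x))"

definition smooth :: "(real \<Rightarrow> 'a::real_normed_vector) \<Rightarrow> bool" where
  "smooth F \<longleftrightarrow> (\<forall>k x. (vderiv ^^ k) F differentiable (at x))"

definition ndiff :: "nat \<Rightarrow> (real \<Rightarrow> 'a::real_normed_vector) \<Rightarrow> bool" where
  "ndiff n F \<longleftrightarrow> (\<forall>k\<le>n. \<forall>x. (vderiv ^^ k) F differentiable (at x))"

lemma smooth_iff_ndiff: "smooth F \<longleftrightarrow> (\<forall>n. ndiff n F)"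
  unfolding smooth_def ndiff_def by blast

lemma ndiff_0: "ndiff 0 F \<longleftrightarrow> (\<forall>x. F differentiable (at x))"
  by (simp add: ndiff_def)

lemma ndiff_Suc: "ndiff (Suc n) F \<longleftrightarrow> (\<forall>x. F differentiable (at x)) \<and> ndiff n (vderiv F)"
proof -
  have "(\<forall>k\<le>Suc n. P k) \<longleftrightarrow> P 0 \<and> (\<forall>k\<le>n. P (Suc k))" for P :: "nat \<Rightarrow> bool"
    by (metis Suc_le_mono le0 not0_implies_Suc)
  then show ?thesis
    unfolding ndiff_def by (simp add: funpow_Suc_right del: funpow.simps(2))
qed

lemma ndiff_mono: "ndiff n F \<Longrightarrow> m \<le> n \<Longrightarrow> ndiff m F"
  unfolding ndiff_def by auto

lemma ndiff_differentiable: "ndiff n F \<Longrightarrow> F differentiable (at x)"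
  by (metis ndiff_0 ndiff_mono le0)

lemma ndiff_add: "ndiff n F \<Longrightarrow> ndiff n G \<Longrightarrow> ndiff n (\<lambda>x. F x + G x)"
proof (induction n arbitrary: F G)
  case 0
  then show ?case by (simp add: ndiff_0)
next
  case (Suc n)
  have "vderiv (\<lambda>x. F x + G x) = (\<lambda>x. vderiv F x + vderiv G x)"
    using Suc.prems by (auto simp: ndiff_Suc intro!: ext vector_derivative_at
        has_vector_derivative_add simp flip: vector_derivative_works)
  then show ?case using Suc by (simp add: ndiff_Suc)
qed

lemma differentiable_bilinear:
  assumes "bounded_bilinear pr" "F differentiable (at x)" "G differentiable (at x)"
  shows "(\<lambda>x. pr (F x) (G x)) differentiable (at x)"
  using bounded_bilinear.FDERIV[OF assms(1)] assms(2,3) unfolding differentiable_def by blast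

lemma ndiff_bilinear:
  assumes b: "bounded_bilinear pr"
  shows "ndiff n F \<Longrightarrow> ndiff n G \<Longrightarrow> ndiff n (\<lambda>x. pr (F x) (G x))"
proof (induction n arbitrary: F G)
  case 0
  then show ?case by (simp add: ndiff_0 differentiable_bilinear[OF b])
next
  case (Suc n)
  have "vderiv (\<lambda>x. pr (F x) (G x)) = (\<lambda>x. pr (F x) (vderiv G x) + pr (vderiv F x) (G x))"
    using Suc.prems by (auto simp: ndiff_Suc intro!: ext vector_derivative_at
        bounded_bilinear.has_vector_derivative[OF b] simp flip: vector_derivative_works)
  moreover have "ndiff n F" "ndiff n G"
    using Suc.prems ndiff_mono le_SucI by blast+
  ultimately show ?case
    using Suc by (simp add: ndiff_Suc ndiff_add differentiable_bilinear[OF b])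
qed

lemma smooth_const: "smooth (\<lambda>_. c)"
proof -
  have "ndiff n (\<lambda>_. c)" for n
    by (induction n arbitrary: c) (auto simp: ndiff_0 ndiff_Suc)
  then show ?thesis by (simp add: smooth_iff_ndiff)
qed

lemma smooth_add: "smooth F \<Longrightarrow> smooth G \<Longrightarrow> smooth (\<lambda>x. F x + G x)"
  by (simp add: smooth_iff_ndiff ndiff_add)

lemma smooth_bilinear:
  "bounded_bilinear pr \<Longrightarrow> smooth F \<Longrightarrow> smooth G \<Longrightarrow> smooth (\<lambda>x. pr (F x) (G x))"
  by (simp add: smooth_iff_ndiff ndiff_bilinear)

lemma smooth_scaleR: "smooth F \<Longrightarrow> smooth (\<lambda>x. c *\<^sub>R F x)"
  using smooth_bilinear[OF bounded_bilinear_scaleR smooth_const] by blast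

lemma smooth_vderiv: "smooth F \<Longrightarrow> smooth (vderiv F)"
  by (auto simp: smooth_iff_ndiff ndiff_Suc[symmetric] dest: spec[where x="Suc _"])
     (metis ndiff_Suc)

lemma smooth_differentiable: "smooth F \<Longrightarrow> F differentiable (at x)"
  by (meson ndiff_differentiable smooth_iff_ndiff)

lemma smooth_ident: "smooth (\<lambda>x::real. x)"
proof -
  have "ndiff n (\<lambda>x::real. x)" for n
    using smooth_const[of "1::real"]
    by (cases n) (auto simp: ndiff_0 ndiff_Suc smooth_iff_ndiff)
  then show ?thesis by (simp add: smooth_iff_ndiff)
qed

lemma matrix_add_rdistrib': "(A + B) ** C = A ** C + B ** (C :: 'a::semiring_1^'n^'m)"
  by (vector matrix_matrix_mult_def sum.distrib[symmetric] field_simps)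

lemma bounded_bilinear_matrix_mult:
  "bounded_bilinear ((**) :: complex^'n^'n \<Rightarrow> complex^'n^'n \<Rightarrow> complex^'n^'n)"
proof -
  have "bilinear ((**) :: complex^'n^'n \<Rightarrow> complex^'n^'n \<Rightarrow> complex^'n^'n)"
    unfolding bilinear_def
    by (auto intro!: linearI simp: matrix_add_ldistrib matrix_add_rdistrib'
        matrix_scalar_ac scalar_matrix_assoc)
  then show ?thesis by (simp add: bilinear_conv_bounded_bilinear)
qed

typedef (overloaded) 'n mfun = "{F :: real \<Rightarrow> complex^'n^'n. smooth F}"
  morphisms mfun_app Mfun
  using smooth_const by blast

setup_lifting type_definition_mfun

lemma mfun_eqI: "(\<And>x. mfun_app F x = mfun_app G x) \<Longrightarrow> F = G"
  by transfer auto

text \<open>The product of functions is the pointwise product of matrices, written out with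
  \<open>**\<close> because \<open>*\<close> on the type \<open>complex^'n^'n\<close> is the entrywise product.\<close>

instantiation mfun :: (finite) ring_1
begin

lift_definition zero_mfun :: "'a mfun" is "\<lambda>_. 0"
  by (rule smooth_const)

lift_definition one_mfun :: "'a mfun" is "\<lambda>_. mat 1"
  by (rule smooth_const)

lift_definition plus_mfun :: "'a mfun \<Rightarrow> 'a mfun \<Rightarrow> 'a mfun" is "\<lambda>F G x. F x + G x"
  by (rule smooth_add)

lift_definition uminus_mfun :: "'a mfun \<Rightarrow> 'a mfun" is "\<lambda>F x. - F x"
  using smooth_scaleR[of _ "-1"] by simp

lift_definition minus_mfun :: "'a mfun \<Rightarrow> 'a mfun \<Rightarrow> 'a mfun" is "\<lambda>F G x. F x - G x"
  using smooth_add[OF _ smooth_scaleR[of _ "-1"]] by simp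

lift_definition times_mfun :: "'a mfun \<Rightarrow> 'a mfun \<Rightarrow> 'a mfun" is "\<lambda>F G x. F x ** G x"
  by (rule smooth_bilinear[OF bounded_bilinear_matrix_mult])

instance
proof
  have "(mat 1 :: complex^'a^'a) \<noteq> 0"
    by (auto simp: mat_def vec_eq_iff)
  then show "(0::'a mfun) \<noteq> 1" by transfer (metis (mono_tags))
qed (transfer; simp add: fun_eq_iff algebra_simps matrix_mul_assoc matrix_add_ldistrib
      matrix_add_rdistrib')+

end

lift_definition const_mfun :: "complex^'n^'n \<Rightarrow> 'n::finite mfun" is "\<lambda>M _. M"
  by (rule smooth_const)

text \<open>The function \<open>x \<mapsto> x I\<close>.\<close>

lift_definition xI :: "'n::finite mfun" is "\<lambda>x. mat (complex_of_real x)"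
proof -
  have "mat (complex_of_real x) = x *\<^sub>R (mat 1 :: complex^'n^'n)" for x
    by (simp add: mat_def vec_eq_iff) (simp add: scaleR_conv_of_real)
  then show "smooth (\<lambda>x. mat (complex_of_real x) :: complex^'n^'n)"
    using smooth_bilinear[OF bounded_bilinear_scaleR smooth_ident smooth_const] by simp
qed

lift_definition mfun_deriv :: "'n::finite mfun \<Rightarrow> 'n mfun" is vderiv
  by (rule smooth_vderiv)

lemma mfun_deriv_add: "mfun_deriv (F + G) = mfun_deriv F + mfun_deriv G"
  by transfer (auto intro!: ext vector_derivative_at has_vector_derivative_add
      simp: smooth_differentiable simp flip: vector_derivative_works)

lemma mfun_deriv_0 [simp]: "mfun_deriv 0 = 0"
  by transfer auto

lemma mfun_deriv_const [simp]: "mfun_deriv (const_mfun M) = 0"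
  by transfer auto

lemma mfun_deriv_mult: "mfun_deriv (F * G) = F * mfun_deriv G + mfun_deriv F * G"
  by transfer (auto intro!: ext vector_derivative_at
      bounded_bilinear.has_vector_derivative[OF bounded_bilinear_matrix_mult]
      simp: smooth_differentiable simp flip: vector_derivative_works)

lemma mfun_deriv_sum: "mfun_deriv (sum F A) = (\<Sum>j\<in>A. mfun_deriv (F j))"
  by (induction A rule: infinite_finite_induct) (auto simp: mfun_deriv_add)

section \<open>The algebra of differential operators acting from the right\<close>

definition diff_operator :: "('n::finite mfun \<Rightarrow> 'n mfun) \<Rightarrow> bool" where
  "diff_operator T \<longleftrightarrow> (\<exists>m G. \<forall>F. T F = (\<Sum>j\<le>m. (mfun_deriv ^^ j) F * G j))"

lemma diff_operator_mult: "diff_operator (\<lambda>F. F * G)"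
  unfolding diff_operator_def by (intro exI[of _ 0] exI[of _ "\<lambda>_. G"]) simp

lemma diff_operator_zero: "diff_operator (\<lambda>F. 0)"
  using diff_operator_mult[of 0] by simp

lemma diff_operator_id: "diff_operator (\<lambda>F. F)"
  using diff_operator_mult[of 1] by simp

lemma diff_operator_pad:
  "(\<Sum>j\<le>m. (mfun_deriv ^^ j) F * G j)
    = (\<Sum>j\<le>m + k. (mfun_deriv ^^ j) F * (if j \<le> m then G j else 0))"
  by (rule sum.mono_neutral_cong_left) auto

lemma diff_operator_add:
  assumes "diff_operator S" "diff_operator T"
  shows "diff_operator (\<lambda>F. S F + T F)"
proof -
  obtain m G where S: "S F = (\<Sum>j\<le>m. (mfun_deriv ^^ j) F * G j)" for F
    using assms(1) unfolding diff_operator_def by blast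
  obtain n H where T: "T F = (\<Sum>j\<le>n. (mfun_deriv ^^ j) F * H j)" for F
    using assms(2) unfolding diff_operator_def by blast
  have "S F + T F = (\<Sum>j\<le>m + n. (mfun_deriv ^^ j) F *
      ((if j \<le> m then G j else 0) + (if j \<le> n then H j else 0)))" for F
    unfolding S T diff_operator_pad[where k=n and m=m] diff_operator_pad[where k=m and m=n]
    by (simp add: sum.distrib distrib_left add.commute)
  then show ?thesis
    unfolding diff_operator_def by (intro exI allI)
qed

lemma diff_operator_rmult:
  assumes "diff_operator S"
  shows "diff_operator (\<lambda>F. S F * G)"
proof -
  obtain m H where S: "S F = (\<Sum>j\<le>m. (mfun_deriv ^^ j) F * H j)" for F
    using assms unfolding diff_operator_def by blast
  have "S F * G = (\<Sum>j\<le>m. (mfun_deriv ^^ j) F * (H j * G))" for F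
    unfolding S by (simp add: sum_distrib_right mult.assoc)
  then show ?thesis
    unfolding diff_operator_def by (intro exI[of _ m] exI[of _ "\<lambda>j. H j * G"]) simp
qed

lemma diff_operator_shift:
  "diff_operator (\<lambda>F. \<Sum>j\<le>m. (mfun_deriv ^^ Suc j) F * H j)"
proof -
  have "(\<Sum>j\<le>m. (mfun_deriv ^^ Suc j) F * H j)
      = (\<Sum>j\<le>Suc m. (mfun_deriv ^^ j) F * (case j of 0 \<Rightarrow> 0 | Suc i \<Rightarrow> H i))" for F
    by (subst sum.atMost_Suc_shift) simp
  then show ?thesis unfolding diff_operator_def
    by (intro exI[of _ "Suc m"] exI[of _ "\<lambda>j. case j of 0 \<Rightarrow> 0 | Suc i \<Rightarrow> H i"]) simp
qed

lemma diff_operator_deriv: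
  assumes "diff_operator S"
  shows "diff_operator (\<lambda>F. mfun_deriv (S F))"
proof -
  obtain m H where S: "S F = (\<Sum>j\<le>m. (mfun_deriv ^^ j) F * H j)" for F
    using assms unfolding diff_operator_def by blast
  have "mfun_deriv (S F) = (\<Sum>j\<le>m. (mfun_deriv ^^ j) F * mfun_deriv (H j)) +
      (\<Sum>j\<le>m. (mfun_deriv ^^ Suc j) F * H j)" for F
    unfolding S by (simp add: mfun_deriv_sum mfun_deriv_mult sum.distrib)
  moreover have "diff_operator (\<lambda>F. \<Sum>j\<le>m. (mfun_deriv ^^ j) F * mfun_deriv (H j))"
    unfolding diff_operator_def by (intro exI[of _ m] exI[of _ "\<lambda>j. mfun_deriv (H j)"]) simp
  ultimately show ?thesis
    using diff_operator_add[OF _ diff_operator_shift] by simp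
qed

lemma diff_operator_deriv_pow:
  assumes "diff_operator S"
  shows "diff_operator (\<lambda>F. (mfun_deriv ^^ k) (S F))"
  by (induction k) (auto simp: assms diff_operator_deriv)

lemma diff_operator_compose:
  assumes "diff_operator S" "diff_operator T"
  shows "diff_operator (\<lambda>F. T (S F))"
proof -
  obtain m H where T: "T F = (\<Sum>j\<le>m. (mfun_deriv ^^ j) F * H j)" for F
    using assms(2) unfolding diff_operator_def by blast
  have "diff_operator (\<lambda>F. \<Sum>j\<le>m. (mfun_deriv ^^ j) (S F) * H j)"
    by (induction m) (auto intro!: diff_operator_add diff_operator_rmult diff_operator_deriv_pow
          diff_operator_deriv simp: assms)
  then show ?thesis by (simp add: T)
qed

lemma diff_operator_additive:
  assumes "diff_operator T"
  shows "T (F + G) = T F + T G"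
proof -
  have "(mfun_deriv ^^ j) (F + G) = (mfun_deriv ^^ j) F + (mfun_deriv ^^ j) G" for j
    by (induction j) (auto simp: mfun_deriv_add)
  with assms show ?thesis
    by (auto simp: diff_operator_def distrib_right sum.distrib)
qed

typedef (overloaded) 'n diffop = "{T :: 'n::finite mfun \<Rightarrow> 'n mfun. diff_operator T}"
  morphisms act Diffop
  using diff_operator_zero by blast

setup_lifting type_definition_diffop

lemma diffop_eqI: "(\<And>F. act S F = act T F) \<Longrightarrow> S = T"
  by transfer auto

lemma act_add_right: "act T (F + G) = act T F + act T G"
  by transfer (rule diff_operator_additive)

abbreviation right_act :: "'n::finite mfun \<Rightarrow> 'n diffop \<Rightarrow> 'n mfun"  (infixl "\<triangleleft>" 70) where
  "F \<triangleleft> T \<equiv> act T F"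

text \<open>In a product the left factor acts first: \<open>F \<triangleleft> (S * T) = (F \<triangleleft> S) \<triangleleft> T\<close>.\<close>

instantiation diffop :: (finite) ring_1
begin

lift_definition zero_diffop :: "'a diffop" is "\<lambda>F. 0"
  by (rule diff_operator_zero)

lift_definition one_diffop :: "'a diffop" is "\<lambda>F. F"
  by (rule diff_operator_id)

lift_definition plus_diffop :: "'a diffop \<Rightarrow> 'a diffop \<Rightarrow> 'a diffop" is "\<lambda>S T F. S F + T F"
  by (rule diff_operator_add)

lift_definition uminus_diffop :: "'a diffop \<Rightarrow> 'a diffop" is "\<lambda>S F. - S F"
  using diff_operator_rmult[of _ "-1"] by simp

lift_definition minus_diffop :: "'a diffop \<Rightarrow> 'a diffop \<Rightarrow> 'a diffop" is "\<lambda>S T F. S F - T F"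
  using diff_operator_add[OF _ diff_operator_rmult[of _ "-1"]] by simp

lift_definition times_diffop :: "'a diffop \<Rightarrow> 'a diffop \<Rightarrow> 'a diffop" is "\<lambda>S T F. T (S F)"
  by (rule diff_operator_compose)

instance
proof
  show "(0::'a diffop) \<noteq> 1"
  proof
    assume "(0::'a diffop) = 1"
    then have "act 0 (1::'a mfun) = act 1 1" by simp
    then show False by (simp add: zero_diffop.rep_eq one_diffop.rep_eq)
  qed
qed (rule diffop_eqI; simp add: zero_diffop.rep_eq one_diffop.rep_eq plus_diffop.rep_eq
      uminus_diffop.rep_eq minus_diffop.rep_eq times_diffop.rep_eq act_add_right algebra_simps)+

end

text \<open>The operator \<open>F \<mapsto> F G\<close> of order zero, and \<open>\<partial>\<^sub>x\<close>; with these
  \<open>\<partial>\<^sub>x ^ j * mult_op G\<close> is the operator \<open>F \<mapsto> F\<^sup>(\<^sup>j\<^sup>) G\<close>.\<close>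

definition mult_op :: "'n::finite mfun \<Rightarrow> 'n diffop" where
  "mult_op G = Diffop (\<lambda>F. F * G)"

lift_definition partial_x :: "'n::finite diffop"  ("\<partial>\<^sub>x") is mfun_deriv
  using diff_operator_deriv[OF diff_operator_id] by simp

lift_definition scale_op :: "complex \<Rightarrow> 'n::finite diffop \<Rightarrow> 'n diffop"  (infixr "*\<^sub>C" 75)
  is "\<lambda>c T F. T F * const_mfun (mat c)"
  by (rule diff_operator_rmult)

lemma act_mult_op: "F \<triangleleft> mult_op G = F * G"
  by (simp add: mult_op_def Diffop_inverse diff_operator_mult)
lemma act_partial_x: "F \<triangleleft> \<partial>\<^sub>x = mfun_deriv F" by (simp add: partial_x.rep_eq)
lemma act_one: "F \<triangleleft> 1 = F" by (simp add: one_diffop.rep_eq)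
lemma act_add: "F \<triangleleft> (S + T) = F \<triangleleft> S + F \<triangleleft> T" by (simp add: plus_diffop.rep_eq)
lemma act_uminus: "F \<triangleleft> (- S) = - (F \<triangleleft> S)" by (simp add: uminus_diffop.rep_eq)
lemma act_diff: "F \<triangleleft> (S - T) = F \<triangleleft> S - F \<triangleleft> T" by (simp add: minus_diffop.rep_eq)
lemma act_times: "F \<triangleleft> (S * T) = (F \<triangleleft> S) \<triangleleft> T" by (simp add: times_diffop.rep_eq)

lemma mfun_app_scale: "mfun_app (F \<triangleleft> (c *\<^sub>C T)) x $ i $ j = c * mfun_app (F \<triangleleft> T) x $ i $ j"
proof -
  have "mfun_app (G * const_mfun (mat c)) x $ i $ j = c * mfun_app G x $ i $ j" for G :: "'a mfun"
    by transfer (simp add: matrix_matrix_mult_def mat_def if_distrib[of "(*) _"]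
        sum.delta sum.delta' mult.commute cong: if_cong)
  then show ?thesis by (simp add: scale_op.rep_eq)
qed

lemma diffop_eqI_entries:
  "(\<And>F x i j. mfun_app (F \<triangleleft> S) x $ i $ j = mfun_app (F \<triangleleft> T) x $ i $ j) \<Longrightarrow> S = T"
  by (intro diffop_eqI mfun_eqI) (simp add: vec_eq_iff)

lemma diff_operator_scale_arg:
  "act T (F * const_mfun (mat c)) = act T F * const_mfun (mat c)"
proof -
  have comm: "G * const_mfun (mat c) = const_mfun (mat c) * G" for G :: "'a mfun"
    by transfer (simp add: fun_eq_iff matrix_matrix_mult_def mat_def vec_eq_iff
        if_distrib[of "(*) _"] if_distrib[of "\<lambda>z. z * _"] mult.commute cong: if_cong)
  have "(mfun_deriv ^^ j) (const_mfun (mat c) * F) = const_mfun (mat c) * (mfun_deriv ^^ j) F" for j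
    by (induction j) (auto simp: mfun_deriv_mult)
  then show ?thesis
    using act[of T] unfolding comm
    by (auto simp: diff_operator_def sum_distrib_left mult.assoc)
qed

lemma scale_op_mult_left: "(c *\<^sub>C S) * T = c *\<^sub>C (S * T)"
  by (rule diffop_eqI) (simp add: act_times scale_op.rep_eq diff_operator_scale_arg)

lemma scale_op_mult_right: "S * (c *\<^sub>C T) = c *\<^sub>C (S * T)"
  by (rule diffop_eqI) (simp add: act_times scale_op.rep_eq)

lemma mfun_app_add: "mfun_app (F + G) x = mfun_app F x + mfun_app G x" by transfer simp

lemma vector_space_scale_op: "vector_space ((*\<^sub>C) :: complex \<Rightarrow> 'n::finite diffop \<Rightarrow> _)"
  by unfold_locales
     (auto intro!: diffop_eqI_entries simp: mfun_app_scale act_add mfun_app_add algebra_simps)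

definition commutator :: "'a::ring \<Rightarrow> 'a \<Rightarrow> 'a" where
  "commutator S T = S * T - T * S"

section \<open>Complex Lie algebras\<close>

text \<open>A complex Lie algebra, given as a subspace \<open>L\<close> of an ambient complex vector space.\<close>

locale complex_lie_algebra = vector_space smul
  for smul :: "complex \<Rightarrow> 'v::ab_group_add \<Rightarrow> 'v" +
  fixes bracket :: "'v \<Rightarrow> 'v \<Rightarrow> 'v"
    and L :: "'v set"
  assumes subspace_L: "subspace L"
    and bracket_closed: "X \<in> L \<Longrightarrow> Y \<in> L \<Longrightarrow> bracket X Y \<in> L"
    and bracket_add_left:
      "X \<in> L \<Longrightarrow> Y \<in> L \<Longrightarrow> Z \<in> L \<Longrightarrow> bracket (X + Y) Z = bracket X Z + bracket Y Z"
    and bracket_add_right: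
      "X \<in> L \<Longrightarrow> Y \<in> L \<Longrightarrow> Z \<in> L \<Longrightarrow> bracket X (Y + Z) = bracket X Y + bracket X Z"
    and bracket_scale_left:
      "X \<in> L \<Longrightarrow> Y \<in> L \<Longrightarrow> bracket (smul c X) Y = smul c (bracket X Y)"
    and bracket_scale_right:
      "X \<in> L \<Longrightarrow> Y \<in> L \<Longrightarrow> bracket X (smul c Y) = smul c (bracket X Y)"
    and bracket_self: "X \<in> L \<Longrightarrow> bracket X X = 0"
    and jacobi: "X \<in> L \<Longrightarrow> Y \<in> L \<Longrightarrow> Z \<in> L \<Longrightarrow>
      bracket X (bracket Y Z) + bracket Y (bracket Z X) + bracket Z (bracket X Y) = 0"

locale harmonic_oscillator_algebra = complex_lie_algebra +
  assumes harmonic_oscillator_basis: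
    "\<exists>Jp Jm J3 E. distinct [Jp, Jm, J3, E] \<and> independent {Jp, Jm, J3, E} \<and>
       span {Jp, Jm, J3, E} = L \<and>
       bracket J3 Jp = Jp \<and> bracket J3 Jm = - Jm \<and> bracket Jp Jm = - E \<and>
       (\<forall>X\<in>L. bracket E X = 0)"

definition lie_subalgebra ::
    "(complex \<Rightarrow> 'v::ab_group_add \<Rightarrow> 'v) \<Rightarrow> ('v \<Rightarrow> 'v \<Rightarrow> 'v) \<Rightarrow> 'v set \<Rightarrow> bool" where
  "lie_subalgebra smul bracket L \<longleftrightarrow>
     module.subspace smul L \<and> (\<forall>X\<in>L. \<forall>Y\<in>L. bracket X Y \<in> L)"

definition lie_generated ::
    "(complex \<Rightarrow> 'v::ab_group_add \<Rightarrow> 'v) \<Rightarrow> ('v \<Rightarrow> 'v \<Rightarrow> 'v) \<Rightarrow> 'v set \<Rightarrow> 'v set" where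
  "lie_generated smul bracket X = lie_subalgebra smul bracket hull X"

lemma complex_lie_algebra_diffop:
  "complex_lie_algebra (*\<^sub>C) commutator (UNIV :: 'n::finite diffop set)"
proof -
  interpret vector_space "(*\<^sub>C) :: complex \<Rightarrow> 'n diffop \<Rightarrow> _"
    by (rule vector_space_scale_op)
  show ?thesis
    by unfold_locales
       (simp_all add: commutator_def algebra_simps scale_op_mult_left scale_op_mult_right)
qed

section \<open>The matrices and operators\<close>

text \<open>Matrix indices range over an arbitrary nonempty finite linearly ordered type \<open>'n\<close>;
  \<open>pos\<close> numbers its elements increasingly by \<open>1, \<dots>, N\<close>, where \<open>N = CARD('n)\<close>.\<close>

definition pos :: "'n::{finite,linorder} \<Rightarrow> nat" where
  "pos i = card {k. k \<le> i}"

lemma bij_betw_pos: "bij_betw pos (UNIV :: 'n::{finite,linorder} set) {1..CARD('n)}"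
proof -
  have "{k. k \<le> x} \<subset> {k. k \<le> y}" if "x < y" for x y :: 'n
    using that by (auto simp: psubset_eq set_eq_iff) (use leD in blast)
  then have "strict_mono (pos :: 'n \<Rightarrow> nat)"
    by (simp add: strict_mono_def pos_def psubset_card_mono)
  then have inj: "inj (pos :: 'n \<Rightarrow> nat)" by (rule strict_mono_imp_inj_on)
  have sub: "pos ` (UNIV :: 'n set) \<subseteq> {1..CARD('n)}"
    by (auto simp: pos_def card_mono Suc_le_eq card_gt_0_iff)
  have "pos ` (UNIV :: 'n set) = {1..CARD('n)}"
    by (rule card_subset_eq[OF _ sub]) (simp_all add: card_image[OF inj])
  with inj show ?thesis by (simp add: bij_betw_def)
qed

definition matA :: "(nat \<Rightarrow> real) \<Rightarrow> complex^('n::{finite,linorder})^('n::{finite,linorder})" where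
  "matA \<alpha> = (\<chi> j k. if pos j = pos k + 1
                      then complex_of_real (2 * \<alpha> (pos k + 1) / \<alpha> (pos k)) else 0)"

definition matJ :: "complex^('n::{finite,linorder})^('n::{finite,linorder})" where
  "matJ = (\<chi> j k. if j = k then of_nat (pos j) else 0)"

definition calD :: "(nat \<Rightarrow> real) \<Rightarrow> 'n::{finite,linorder} diffop" where
  "calD \<alpha> = \<partial>\<^sub>x + mult_op (const_mfun (matA \<alpha>))"

definition calD_dagger :: "(nat \<Rightarrow> real) \<Rightarrow> 'n::{finite,linorder} diffop" where
  "calD_dagger \<alpha> = - \<partial>\<^sub>x - mult_op (const_mfun (matA \<alpha>)) + mult_op (2 * xI)"

definition opD :: "(nat \<Rightarrow> real) \<Rightarrow> 'n::{finite,linorder} diffop" where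
  "opD \<alpha> = - (1/2) *\<^sub>C \<partial>\<^sub>x ^ 2 + \<partial>\<^sub>x * mult_op (xI - const_mfun (matA \<alpha>))
            + mult_op (const_mfun matJ)"

end

theory Submission
  imports Defs
begin

text \<open>
  Write \<open>A\<close>, \<open>J\<close>, \<open>X\<close> for the multiplication operators by the matrices \<open>A\<close>, \<open>J\<close> and by \<open>x I\<close>.
  Everything follows from the relations
  \<open>[X, \<partial>\<^sub>x] = 1\<close> and \<open>[J, A] = A\<close>, all other pairs among \<open>\<partial>\<^sub>x\<close>, \<open>X\<close>, \<open>A\<close>, \<open>J\<close> being
  commuting.  (The first has this sign because the left factor of a product acts first; the second
  holds because \<open>A\<close> lives on the first subdiagonal, on which \<open>pos j - pos k = 1\<close>.)
  By bilinearity and the derivation rule for commutators they give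
  \<open>[\<D>, \<D>\<^sup>\<dagger>] = - 2\<close>, \<open>[D, \<D>] = \<D>\<close> and \<open>[D, \<D>\<^sup>\<dagger>] = - \<D>\<^sup>\<dagger>\<close>,
  so the span of \<open>1, \<D>, \<D>\<^sup>\<dagger>, D\<close> is closed under brackets, and
  \<open>\<J>\<^sup>+ = \<D>\<close>, \<open>\<J>\<^sup>- = \<D>\<^sup>\<dagger>\<close>, \<open>\<J>\<^sup>3 = D\<close>, \<open>\<E> = 2\<close> satisfy the oscillator relations.
  The constant \<open>2\<close> and the identity span the same line, so this basis spans the same space.

  Linear independence need not be checked on functions: it is a consequence of the relations
  and \<open>\<E> \<noteq> 0\<close>.  Brackets with \<open>\<J>\<^sup>+\<close> and \<open>\<J>\<^sup>-\<close> turn a vanishing linear combination into vanishing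
  multiples of \<open>\<E>\<close>, which kills its coefficients one at a time.  In other words, any
  representation of the oscillator algebra that does not kill \<open>\<E>\<close> is faithful.
\<close>

section \<open>Spans closed under the bracket\<close>

context complex_lie_algebra
begin

lemma bracket_zero_left: "X \<in> L \<Longrightarrow> bracket 0 X = 0"
  using bracket_scale_left[of X X 0] by simp

lemma bracket_zero_right: "X \<in> L \<Longrightarrow> bracket X 0 = 0"
  using bracket_scale_right[of X X 0] by simp

lemma bracket_antisym:
  assumes "X \<in> L" "Y \<in> L"
  shows "bracket X Y = - bracket Y X"
proof -
  have sum: "X + Y \<in> L" using assms subspace_add[OF subspace_L] by blast
  have "bracket X Y + bracket Y X = bracket (X + Y) (X + Y)"
    using assms by (simp add: bracket_add_left[OF assms sum] bracket_add_right bracket_self)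
  then have "bracket X Y + bracket Y X = 0"
    using bracket_self[OF sum] by simp
  then show ?thesis by (simp add: eq_neg_iff_add_eq_0)
qed

lemma span_subset_L: "S \<subseteq> L \<Longrightarrow> span S \<subseteq> L"
  by (rule span_minimal[OF _ subspace_L])

text \<open>The bracket is bilinear, so closure spreads from \<open>S\<close> to its span in one argument at a time;
  each step exhibits the elements with the desired property as a subspace containing \<open>S\<close>.\<close>

lemma bracket_in_span:
  assumes S: "S \<subseteq> L" and closed: "\<And>X Y. X \<in> S \<Longrightarrow> Y \<in> S \<Longrightarrow> bracket X Y \<in> span S"
    and X: "X \<in> span S" and Y: "Y \<in> span S"
  shows "bracket X Y \<in> span S"
proof -
  note L = subsetD[OF span_subset_L[OF S]]
  have gen: "bracket X Y \<in> span S" if "X \<in> S" for X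
  proof -
    have XL: "X \<in> L" using that S by blast
    have "subspace {Y \<in> span S. bracket X Y \<in> span S}"
      by (rule subspaceI)
         (auto simp: L XL bracket_zero_right bracket_add_right bracket_scale_right
            intro: span_zero span_add span_scale)
    moreover have "S \<subseteq> {Y \<in> span S. bracket X Y \<in> span S}"
      using closed that by (auto intro: span_base)
    ultimately show ?thesis using Y span_minimal by blast
  qed
  have "subspace {X \<in> span S. bracket X Y \<in> span S}"
    by (rule subspaceI)
       (auto simp: L Y bracket_zero_left bracket_add_left bracket_scale_left
          intro: span_zero span_add span_scale)
  moreover have "S \<subseteq> {X \<in> span S. bracket X Y \<in> span S}"
    using gen by (auto intro: span_base)
  ultimately show ?thesis using X span_minimal by blast
qed

lemma lie_generated_eq_span:
  assumes "S \<subseteq> L" "\<And>X Y. X \<in> S \<Longrightarrow> Y \<in> S \<Longrightarrow> bracket X Y \<in> span S"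
  shows "lie_generated smul bracket S = span S"
  unfolding lie_generated_def
proof (rule hull_unique)
  show "lie_subalgebra smul bracket (span S)"
    using bracket_in_span[OF assms] by (auto simp: lie_subalgebra_def)
  show "S \<subseteq> span S" by (rule span_superset)
  show "span S \<subseteq> M" if "S \<subseteq> M" "lie_subalgebra smul bracket M" for M
    using that by (intro span_minimal) (auto simp: lie_subalgebra_def)
qed

lemma complex_lie_algebra_subalgebra:
  assumes "lie_subalgebra smul bracket M" "M \<subseteq> L"
  shows "complex_lie_algebra smul bracket M"
proof -
  note L = subsetD[OF assms(2)]
  show ?thesis
    using assms(1)
    by unfold_locales
       (auto simp: lie_subalgebra_def L bracket_add_left bracket_add_right bracket_scale_left
          bracket_scale_right bracket_self jacobi)
qed

end

section \<open>Consequences of the oscillator relations\<close>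

locale oscillator_relations = complex_lie_algebra +
  fixes Jp Jm J3 E
  assumes mem: "Jp \<in> L" "Jm \<in> L" "J3 \<in> L" "E \<in> L"
    and J3_Jp: "bracket J3 Jp = Jp"
    and J3_Jm: "bracket J3 Jm = - Jm"
    and Jp_Jm: "bracket Jp Jm = - E"
    and central: "X \<in> L \<Longrightarrow> bracket E X = 0"
    and E_nonzero: "E \<noteq> 0"
begin

lemma reversed_brackets:
  "bracket Jp J3 = - Jp" "bracket Jm J3 = Jm" "bracket Jm Jp = E" "X \<in> L \<Longrightarrow> bracket X E = 0"
  using bracket_antisym[OF mem(1,3)] bracket_antisym[OF mem(2,3)] bracket_antisym[OF mem(2,1)]
    bracket_antisym[OF _ mem(4)] by (simp_all add: J3_Jp J3_Jm Jp_Jm central)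

lemma smul_mem: "X \<in> L \<Longrightarrow> smul c X \<in> L"
  by (rule subspace_scale[OF subspace_L])

lemma add_mem: "X \<in> L \<Longrightarrow> Y \<in> L \<Longrightarrow> X + Y \<in> L"
  by (rule subspace_add[OF subspace_L])

lemmas bracket_expand = mem smul_mem add_mem bracket_add_right bracket_scale_right
  bracket_self J3_Jp J3_Jm Jp_Jm reversed_brackets

text \<open>The double bracket \<open>[\<J>\<^sup>-, [\<J>\<^sup>+, \<cdot>]]\<close> maps the combination to \<open>- c \<E>\<close>; with \<open>c = 0\<close> known,
  the single brackets \<open>[\<J>\<^sup>+, \<cdot>]\<close> and \<open>[\<J>\<^sup>-, \<cdot>]\<close> give \<open>- b \<E>\<close> and \<open>a \<E>\<close>, and only \<open>d \<E>\<close> is left of the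
  combination itself.\<close>

lemma coefficients_zero:
  assumes comb: "smul a Jp + smul b Jm + smul c J3 + smul d E = 0"
  shows "a = 0 \<and> b = 0 \<and> c = 0 \<and> d = 0"
proof -
  have p: "smul b (- E) + smul c (- Jp) = 0"
    using arg_cong[OF comb, of "bracket Jp"] by (simp add: bracket_expand bracket_zero_right)
  then have "smul b E + smul c Jp = 0"
    by (simp add: neg_eq_iff_add_eq_0)
  from arg_cong[OF this, of "bracket Jm"] have c: "c = 0"
    by (simp add: bracket_expand bracket_zero_right E_nonzero)
  with p have b: "b = 0" by (simp add: E_nonzero)
  have "a = 0"
    using arg_cong[OF comb, of "bracket Jm"]
    by (simp add: b c bracket_expand bracket_zero_right E_nonzero)
  with comb b c show ?thesis by (simp add: E_nonzero)
qed

lemma distinct_generators: "distinct [Jp, Jm, J3, E]"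
proof -
  have "Jp \<noteq> Jm" using coefficients_zero[of 1 "-1" 0 0] by auto
  moreover have "Jp \<noteq> J3" using coefficients_zero[of 1 0 "-1" 0] by auto
  moreover have "Jp \<noteq> E" using coefficients_zero[of 1 0 0 "-1"] by auto
  moreover have "Jm \<noteq> J3" using coefficients_zero[of 0 1 "-1" 0] by auto
  moreover have "Jm \<noteq> E" using coefficients_zero[of 0 1 0 "-1"] by auto
  moreover have "J3 \<noteq> E" using coefficients_zero[of 0 0 1 "-1"] by auto
  ultimately show ?thesis by simp
qed

lemma independent_generators: "independent {Jp, Jm, J3, E}"
proof (rule independent_if_scalars_zero)
  fix f X
  assume sum: "(\<Sum>Y\<in>{Jp, Jm, J3, E}. smul (f Y) Y) = 0" and X: "X \<in> {Jp, Jm, J3, E}"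
  have "smul (f Jp) Jp + smul (f Jm) Jm + smul (f J3) J3 + smul (f E) E = 0"
    using sum distinct_generators by (simp add: add.assoc)
  from coefficients_zero[OF this] X show "f X = 0" by auto
qed simp

lemma dim_span_generators: "dim (span {Jp, Jm, J3, E}) = 4"
  using dim_eq_card_independent[OF independent_generators] distinct_generators by simp

lemma bracket_generators:
  "X \<in> {Jp, Jm, J3, E} \<Longrightarrow> Y \<in> {Jp, Jm, J3, E} \<Longrightarrow> bracket X Y \<in> span {Jp, Jm, J3, E}"
  by (auto simp: bracket_self mem J3_Jp J3_Jm Jp_Jm central reversed_brackets span_neg
      span_zero span_base)

text \<open>The generating set is allowed to differ from the basis because the Lie algebra of differential operators is generated
  by the identity, whereas the oscillator relations need \<open>\<E>\<close> to be twice the identity.\<close>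

lemma lie_generated_spanning_set:
  assumes "span S = span {Jp, Jm, J3, E}"
  shows "lie_generated smul bracket S = span {Jp, Jm, J3, E}"
proof -
  have gen: "{Jp, Jm, J3, E} \<subseteq> L" using mem by simp
  have S: "S \<subseteq> span {Jp, Jm, J3, E}" using span_superset[of S] assms by simp
  have "lie_generated smul bracket S = span S"
  proof (rule lie_generated_eq_span)
    show "S \<subseteq> L" using S span_subset_L[OF gen] by blast
    show "bracket X Y \<in> span S" if "X \<in> S" "Y \<in> S" for X Y
      unfolding assms using bracket_in_span[OF gen bracket_generators] that S by blast
  qed
  with assms show ?thesis by simp
qed

lemma harmonic_oscillator_algebra_span:
  "harmonic_oscillator_algebra smul bracket (span {Jp, Jm, J3, E})"
proof -
  have sub: "span {Jp, Jm, J3, E} \<subseteq> L"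
    by (rule span_subset_L) (use mem in auto)
  have "lie_subalgebra smul bracket (span {Jp, Jm, J3, E})"
    using bracket_in_span[of "{Jp, Jm, J3, E}"] mem bracket_generators
    by (simp add: lie_subalgebra_def)
  then interpret sub: complex_lie_algebra smul bracket "span {Jp, Jm, J3, E}"
    using sub by (rule complex_lie_algebra_subalgebra)
  show ?thesis
  proof unfold_locales
    show "\<exists>Kp Km K3 C. distinct [Kp, Km, K3, C] \<and> independent {Kp, Km, K3, C} \<and>
       span {Kp, Km, K3, C} = span {Jp, Jm, J3, E} \<and>
       bracket K3 Kp = Kp \<and> bracket K3 Km = - Km \<and> bracket Kp Km = - C \<and>
       (\<forall>X\<in>span {Jp, Jm, J3, E}. bracket C X = 0)"
      using distinct_generators independent_generators J3_Jp J3_Jm Jp_Jm central sub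
      by (intro exI[of _ Jp] exI[of _ Jm] exI[of _ J3] exI[of _ E]) blast
  qed
qed

end

section \<open>Commutation relations of the differential operators\<close>

lemma mult_op_add: "mult_op (F + G) = mult_op F + mult_op G"
  by (rule diffop_eqI) (simp add: act_mult_op act_add distrib_left)

lemma mult_op_diff: "mult_op (F - G) = mult_op F - mult_op G"
  by (rule diffop_eqI) (simp add: act_mult_op act_diff right_diff_distrib)

lemma mult_op_mult: "mult_op F * mult_op G = mult_op (F * G)"
  by (rule diffop_eqI) (simp add: act_mult_op act_times mult.assoc)

lemma mult_op_one: "mult_op 1 = 1"
  by (rule diffop_eqI) (simp add: act_mult_op act_one)

text \<open>This is the Leibniz rule \<open>(F G)' = F' G + F G'\<close>, read as an identity between operators
  applied to \<open>F\<close> from the right.\<close>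

lemma mult_op_partial_x: "mult_op G * \<partial>\<^sub>x = \<partial>\<^sub>x * mult_op G + mult_op (mfun_deriv G)"
  by (rule diffop_eqI)
     (simp add: act_mult_op act_times act_add act_partial_x mfun_deriv_mult add.commute)

lemma mfun_deriv_xI: "mfun_deriv (xI :: 'n::finite mfun) = 1"
proof (transfer, rule ext)
  fix x :: real
  have "((\<lambda>x. x *\<^sub>R (mat 1 :: complex^'n^'n)) has_vector_derivative 1 *\<^sub>R mat 1) (at x)"
    by (intro derivative_eq_intros) auto
  moreover have "x *\<^sub>R mat 1 = (mat (complex_of_real x) :: complex^'n^'n)" for x
    by (simp add: mat_def vec_eq_iff) (simp add: scaleR_conv_of_real)
  ultimately show "vderiv (\<lambda>x. mat (complex_of_real x) :: complex^'n^'n) x = mat 1"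
    by (auto intro: vector_derivative_at)
qed

lemma mat_commutes: "mat c ** M = M ** (mat c :: 'a::comm_semiring_1^'n^'n)"
  by (simp add: vec_eq_iff matrix_matrix_mult_def mat_def if_distrib[of "(*) _"]
      if_distrib[of "\<lambda>z. z * _"] mult.commute cong: if_cong)

lemma xI_commutes_const: "xI * const_mfun M = const_mfun M * xI"
  by transfer (simp add: mat_commutes)

lemma matJ_mult_entry:
  "(matJ ** M) $ j $ k = of_nat (pos j) * M $ j $ k"
  "(M ** matJ) $ j $ k = of_nat (pos k) * M $ j $ k"
  by (simp_all add: matrix_matrix_mult_def matJ_def if_distrib[of "(*) _"]
      if_distrib[of "\<lambda>z. z * _"] mult.commute cong: if_cong)

text \<open>\<open>J\<close> is diagonal, so \<open>[J, A]\<close> multiplies the \<open>(j, k)\<close> entry of \<open>A\<close> by \<open>pos j - pos k\<close>, which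
  is \<open>1\<close> wherever \<open>A\<close> is not zero.\<close>

lemma matJ_matA: "matJ ** matA \<alpha> = matA \<alpha> ** matJ + matA \<alpha>"
  by (simp add: vec_eq_iff matJ_mult_entry) (simp add: matA_def distrib_right add_divide_distrib)

lemma const_mfun_matJ_matA:
  "const_mfun matJ * const_mfun (matA \<alpha>)
    = const_mfun (matA \<alpha>) * const_mfun matJ + const_mfun (matA \<alpha>)"
  by transfer (simp add: matJ_matA)

lemma commutator_ring:
  fixes S T U :: "'a::ring"
  shows "commutator S S = 0"
    and "commutator (S + T) U = commutator S U + commutator T U"
    and "commutator U (S + T) = commutator U S + commutator U T"
    and "commutator (S - T) U = commutator S U - commutator T U"
    and "commutator U (S - T) = commutator U S - commutator U T"
    and "commutator (- S) U = - commutator S U"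
    and "commutator U (- S) = - commutator U S"
    and "commutator (S * T) U = S * commutator T U + commutator S U * T"
  by (simp_all add: commutator_def algebra_simps)

lemma commutator_one: "commutator 1 (T :: 'a::ring_1) = 0"
  by (simp add: commutator_def)

lemma commutator_scale_left: "commutator (c *\<^sub>C S) T = c *\<^sub>C commutator S T"
proof -
  interpret complex_lie_algebra "(*\<^sub>C)" commutator "UNIV :: 'a diffop set"
    by (rule complex_lie_algebra_diffop)
  show ?thesis by (simp add: bracket_scale_left)
qed

lemma commutator_mult_op_partial_x:
  "commutator (mult_op G) \<partial>\<^sub>x = mult_op (mfun_deriv G)"
  "commutator \<partial>\<^sub>x (mult_op G) = - mult_op (mfun_deriv G)"
  by (simp_all add: commutator_def mult_op_partial_x)

lemma commutator_mult_op: "commutator (mult_op F) (mult_op G) = mult_op (commutator F G)"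
  by (simp add: commutator_def mult_op_mult mult_op_diff)

lemma mult_op_zero: "mult_op 0 = 0"
  by (rule diffop_eqI) (simp add: act_mult_op zero_diffop.rep_eq)

lemma commutator_coefficients:
  "commutator xI (const_mfun M) = 0" "commutator (const_mfun M) xI = 0"
  "commutator (const_mfun matJ) (const_mfun (matA \<alpha>)) = const_mfun (matA \<alpha>)"
  by (simp_all add: commutator_def xI_commutes_const const_mfun_matJ_matA)

lemma mult_op_two_xI: "mult_op (2 * xI) = mult_op xI + mult_op xI"
  by (simp add: mult_2 mult_op_add)

lemma scale_op_double:
  "2 *\<^sub>C T = T + T" "- (1/2) *\<^sub>C (- T - T) = T"
proof -
  interpret vector_space "(*\<^sub>C) :: complex \<Rightarrow> 'a diffop \<Rightarrow> _"
    by (rule vector_space_scale_op)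
  show "2 *\<^sub>C T = T + T"
    using scale_left_distrib[of 1 1 T] by simp
  show "- (1/2) *\<^sub>C (- T - T) = T"
    using scale_left_distrib[of "1/2" "1/2" T] by (simp add: scale_right_diff_distrib)
qed

lemma scale_op_zero: "c *\<^sub>C 0 = 0"
  using scale_op_mult_right[of 0 c 0] by simp

text \<open>As rewrite rules these reduce the commutators of \<open>\<D>\<close>, \<open>\<D>\<^sup>\<dagger>\<close>, \<open>D\<close> to commutators of \<open>\<partial>\<^sub>x\<close>, \<open>X\<close>,
  \<open>A\<close>, \<open>J\<close>.  The derivation rule is included for a product on the left only, so the relations
  below have \<open>D\<close>, which alone contains products, as the left argument.\<close>

lemmas operator_commutators = commutator_ring commutator_mult_op_partial_x commutator_mult_op
  commutator_coefficients commutator_scale_left mfun_deriv_xI mult_op_one mult_op_zero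
  mult_op_two_xI mult_op_diff power2_eq_square scale_op_zero

lemma commutator_calD_calD_dagger: "commutator (calD \<alpha>) (calD_dagger \<alpha>) = - (2 *\<^sub>C 1)"
  by (simp add: calD_def calD_dagger_def operator_commutators scale_op_double)

lemma commutator_opD_calD: "commutator (opD \<alpha>) (calD \<alpha>) = calD \<alpha>"
  by (simp add: calD_def opD_def operator_commutators)

text \<open>The second-order term of \<open>D\<close> is what makes \<open>\<D>\<^sup>\<dagger>\<close> an eigenvector: it contributes
  \<open>- 1/2 [\<partial>\<^sub>x\<^sup>2, 2 X] = 2 \<partial>\<^sub>x\<close>, which turns the \<open>- \<partial>\<^sub>x\<close> coming from the
  first-order term into the \<open>\<partial>\<^sub>x\<close> of \<open>- \<D>\<^sup>\<dagger>\<close>.\<close>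

lemma commutator_opD_calD_dagger: "commutator (opD \<alpha>) (calD_dagger \<alpha>) = - calD_dagger \<alpha>"
  by (simp add: calD_dagger_def opD_def operator_commutators scale_op_double)

section \<open>The harmonic oscillator algebra\<close>

theorem proposition5p6:
  fixes \<alpha> :: "nat \<Rightarrow> real"
  assumes "\<And>k. 1 \<le> k \<Longrightarrow> k \<le> CARD('n::{finite,linorder}) \<Longrightarrow> \<alpha> k > 0"
  defines "\<hh> \<equiv> lie_generated (*\<^sub>C) commutator
      {1 :: 'n diffop, calD \<alpha>, calD_dagger \<alpha>, opD \<alpha>}"
  shows "vector_space.dim (*\<^sub>C) \<hh> = 4 \<and>
         harmonic_oscillator_algebra (*\<^sub>C) commutator \<hh>"
proof -
  interpret complex_lie_algebra "(*\<^sub>C)" commutator "UNIV :: 'n diffop set"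
    by (rule complex_lie_algebra_diffop)
  interpret oscillator_relations "(*\<^sub>C)" commutator "UNIV :: 'n diffop set"
    "calD \<alpha>" "calD_dagger \<alpha>" "opD \<alpha>" "2 *\<^sub>C 1"
    by unfold_locales
       (simp_all add: commutator_calD_calD_dagger commutator_opD_calD commutator_opD_calD_dagger
          commutator_scale_left commutator_one)
  let ?B = "{calD \<alpha>, calD_dagger \<alpha>, opD \<alpha>, 2 *\<^sub>C (1 :: 'n diffop)}"
  have "(1 :: 'n diffop) \<in> span ?B"
    using span_scale[OF span_base, of "2 *\<^sub>C 1" ?B "1/2"] by simp
  moreover have "2 *\<^sub>C (1 :: 'n diffop) \<in> span {1, calD \<alpha>, calD_dagger \<alpha>, opD \<alpha>}"
    by (intro span_scale span_base) simp
  ultimately have "span {1 :: 'n diffop, calD \<alpha>, calD_dagger \<alpha>, opD \<alpha>} = span ?B"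
    by (auto simp: span_eq intro: span_base)
  then have "\<hh> = span ?B"
    unfolding \<hh>_def by (rule lie_generated_spanning_set)
  then show ?thesis
    using dim_span_generators harmonic_oscillator_algebra_span by simp
qed

end
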